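(* Let $\mathbf{X}_1, \mathbf{X}_2 \in \mathbb{R}^{m\times n}$ be two real matrices. For $\alpha \in [0,1]$ let $\mathbf{X}(\alpha) := \alpha \mathbf{X}_1 + (1-\alpha)\mathbf{X}_2$ and let $\mathbf{G}(\alpha) := \mathbf{X}(\alpha)\mathbf{X}(\alpha)' \in \mathbb{R}^{m\times m}$ be its Gram matrix. Let $K \ge 1$ be an integer and, for $k=0,1,\ldots,K$, let $\alpha_k := \frac{k}{K}$. For each $\alpha\in[0,1]$, let the (non-negative) eigenvalues of $\mathbf{G}(\alpha)$, counted with multiplicity, be ordered as $\lambda_1(\mathbf{G}(\alpha)) \geq \lambda_2(\mathbf{G}(\alpha)) \geq \cdots \geq \lambda_m(\mathbf{G}(\alpha))$. Then, for every $k \in \{0,1,\ldots,K-1\}$, every $\alpha \in [\alpha_k,\alpha_{k+1}]$ and every $i = 1,\ldots,m$, $$|\lambda_i(\mathbf{G}(\alpha)) - \lambda_i(\mathbf{G}(\alpha_k))| \leq \frac{2}{K}\left(\sigma_1(\mathbf{X}_1)+\sigma_1(\mathbf{X}_2)\right)^2,$$ where $\sigma_1(\cdot)$ denotes the largest singular value of a matrix.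
   Context: The prime $'$ denotes matrix transposition. The integers $m,n \ge 1$ are arbitrary (both $m \le n$ and $m > n$ are allowed). The matrix $\mathbf{G}(\alpha)$ is symmetric and positive semi-definite, so it has $m$ real non-negative eigenvalues counted with multiplicity. *)

theory Defs
  imports "HOL-Library.Multiset" "Jordan_Normal_Form.Char_Poly"
begin

(* Real roots of the characteristic polynomial, repeated according to algebraic multiplicity,
   in decreasing order.  For a symmetric matrix of size m all roots are real, so that the list
   has length m. *)
definition eigvals_desc :: "real mat \<Rightarrow> real list" where
  "eigvals_desc A = rev (sorted_list_of_multiset (proots (char_poly A)))"

(* Indices start at 1, as in lambda_1 >= lambda_2 >= ... >= lambda_m. *)
definition eigval :: "nat \<Rightarrow> real mat \<Rightarrow> real" where
  "eigval i A = eigvals_desc A ! (i - 1)"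

(* sigma_i(X) for i = 1, ..., min m n, where X is an m x n matrix *)
definition singval :: "nat \<Rightarrow> real mat \<Rightarrow> real" where
  "singval i X = sqrt (eigval i (transpose_mat X * X))"

definition gram_mat :: "real mat \<Rightarrow> real mat" where
  "gram_mat X = X * transpose_mat X"

definition interp_mat :: "real mat \<Rightarrow> real mat \<Rightarrow> real \<Rightarrow> real mat" where
  "interp_mat X1 X2 \<alpha> = \<alpha> \<cdot>\<^sub>m X1 + (1 - \<alpha>) \<cdot>\<^sub>m X2"

end

(* The difference of the quadratic forms of G(a) and G(b) at v is |X(a)'v|^2 - |X(b)'v|^2.
   Factoring it as a difference of squares, the first factor is at most |a - b| s |v| and the
   second at most 2 s |v|, where s = sigma_1(X1) + sigma_1(X2).  By the Courant-Fischer dimension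
   count, a bound c |v|^2 on the difference of two quadratic forms bounds the difference of the
   ordered eigenvalues by c. *)

theory Submission
  imports Defs "Jordan_Normal_Form.Schur_Decomposition" "HOL-Analysis.L2_Norm"
begin

section \<open>The characteristic polynomial of a real symmetric matrix\<close>

text \<open>Since the entries of \<open>A\<close> are real, conjugating an eigenvector for
  \<open>a\<close> gives one for \<open>cnj a\<close>. Symmetry moves the matrix across
  \<open>v \<bullet> conjugate v\<close>, which is nonzero, and this forces
  \<open>a = cnj a\<close>.\<close>

lemma root_char_poly_symmetric_real:
  fixes A :: "real mat"
  assumes A: "A \<in> carrier_mat n n" and sym: "transpose_mat A = A"
    and root: "poly (char_poly (map_mat complex_of_real A)) a = 0"
  shows "a \<in> \<real>"
proof -
  let ?C = "map_mat complex_of_real A"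
  have C: "?C \<in> carrier_mat n n" using A by auto
  have symC: "transpose_mat ?C = ?C" 
  proof -
    have "transpose_mat ?C = map_mat complex_of_real (transpose_mat A)"
      by (rule eq_matI) auto
    thus ?thesis unfolding sym .
  qed
  obtain v where v: "v \<in> carrier_vec n" "v \<noteq> 0\<^sub>v n" and ev: "?C *\<^sub>v v = a \<cdot>\<^sub>v v"
    using root C unfolding eigenvalue_root_char_poly[OF C, symmetric] eigenvalue_def eigenvector_def
    by auto
  have cv: "conjugate v \<in> carrier_vec n" using v by auto
  have "conjugate (?C *\<^sub>v v) = ?C *\<^sub>v conjugate v"
    using A v by (intro eq_vecI) (auto simp: scalar_prod_def sum_conjugate)
  hence evc: "?C *\<^sub>v conjugate v = cnj a \<cdot>\<^sub>v conjugate v"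
    unfolding ev by (simp add: conjugate_smult_vec)
  have "a * (v \<bullet> conjugate v) = (?C *\<^sub>v v) \<bullet> conjugate v"
    unfolding ev using v cv by simp
  also have "\<dots> = v \<bullet> (?C *\<^sub>v conjugate v)"
    using transpose_vec_mult_scalar[OF C cv v(1)] unfolding symC .
  also have "\<dots> = cnj a * (v \<bullet> conjugate v)"
    unfolding evc using v cv by simp
  finally have "a = cnj a"
    using conjugate_square_eq_0_vec[OF v(1)] v(2) by simp
  thus ?thesis by (metis Reals_cnj_iff)
qed

text \<open>Over the complex numbers the polynomial splits; all roots are real, so the factorization
  is the image of a real one under the injective embedding of real polynomials.\<close>

lemma char_poly_symmetric_splits:
  fixes A :: "real mat"
  assumes A: "A \<in> carrier_mat n n" and sym: "transpose_mat A = A"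
  shows "\<exists>rs. char_poly A = (\<Prod>r\<leftarrow>rs. [:- r, 1:])"
proof -
  let ?C = "map_mat complex_of_real A"
  interpret map_poly_inj_idom_hom complex_of_real ..
  have C: "?C \<in> carrier_mat n n" using A by auto
  obtain as where as: "char_poly ?C = (\<Prod>a\<leftarrow>as. [:- a, 1:])"
    using char_poly_factorized[OF C] by auto
  have real: "a \<in> \<real>" if "a \<in> set as" for a
  proof (rule root_char_poly_symmetric_real[OF A sym])
    show "poly (char_poly ?C) a = 0"
      unfolding as poly_prod_list using that by (auto simp: prod_list_zero_iff)
  qed
  define rs where "rs = map Re as"
  have as_rs: "as = map complex_of_real rs"
    unfolding rs_def using real by (simp add: map_idI)
  have "map_poly complex_of_real (char_poly A) = char_poly ?C"
    by (rule of_real_hom.char_poly_hom[OF A, symmetric])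
  also have "\<dots> = map_poly complex_of_real (\<Prod>r\<leftarrow>rs. [:- r, 1:])"
    unfolding as as_rs hom_prod_list by (simp add: o_def)
  finally show ?thesis by (auto dest: injectivity)
qed

lemma proots_prod_linear:
  "proots (\<Prod>r\<leftarrow>rs. [:- r, 1:]) = mset (rs :: 'a :: idom list)"
proof (induction rs)
  case (Cons r rs)
  have nz: "[:- r, 1:] \<noteq> 0" "(\<Prod>r\<leftarrow>rs. [:- r, 1:]) \<noteq> 0"
    by (auto simp: prod_list_zero_iff)
  have "proots ([:- r, 1:] * (\<Prod>r\<leftarrow>rs. [:- r, 1:])) = add_mset r (mset rs)"
    unfolding proots_mult[OF nz] Cons.IH by simp
  thus ?case by simp
qed simp

text \<open>Because the polynomial splits, \<open>eigvals_desc A\<close> is a rearrangement of the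
  roots in any factorization into linear factors, so no eigenvalue is missing from the list and
  indexing below \<open>n\<close> is meaningful.\<close>

lemma char_poly_eigvals_desc:
  assumes A: "A \<in> carrier_mat n n" and sym: "transpose_mat A = A"
  shows "char_poly A = (\<Prod>r\<leftarrow>eigvals_desc A. [:- r, 1:])"
    and "length (eigvals_desc A) = n"
    and "i \<le> j \<Longrightarrow> j < n \<Longrightarrow> eigvals_desc A ! j \<le> eigvals_desc A ! i"
proof -
  obtain rs where rs: "char_poly A = (\<Prod>r\<leftarrow>rs. [:- r, 1:])"
    using char_poly_symmetric_splits[OF A sym] by auto
  have mset: "mset (eigvals_desc A) = mset rs"
    unfolding eigvals_desc_def rs proots_prod_linear by simp
  have "(\<Prod>r\<leftarrow>eigvals_desc A. [:- r, 1:]) = (\<Prod>r\<leftarrow>rs. [:- r, 1:])"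
    by (metis mset mset_map prod_mset_prod_list)
  thus cp: "char_poly A = (\<Prod>r\<leftarrow>eigvals_desc A. [:- r, 1:])"
    unfolding rs by simp
  show len: "length (eigvals_desc A) = n"
    using degree_monic_char_poly[OF A] degree_linear_factors[of uminus "eigvals_desc A"]
    unfolding cp by simp
  have "sorted_wrt (\<ge>) (eigvals_desc A)"
    unfolding eigvals_desc_def sorted_wrt_rev by simp
  thus "eigvals_desc A ! j \<le> eigvals_desc A ! i" if "i \<le> j" "j < n"
    using that len by (cases "i = j") (auto simp: sorted_wrt_iff_nth_less)
qed

section \<open>The spectral theorem\<close>

text \<open>Complete \<open>v\<close> to a basis and apply Gram-Schmidt, which keeps the first
  vector.\<close>

lemma orthogonal_completion:
  fixes v :: "real vec"
  assumes v: "v \<in> carrier_vec n" and v1: "v \<bullet> v = 1" 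
  shows "\<exists>W \<in> carrier_mat n n. transpose_mat W * W = 1\<^sub>m n \<and> col W 0 = v"
proof -
  interpret cof_vec_space n "TYPE(real)" .
  have v0: "v \<noteq> 0\<^sub>v n" using v1 by auto
  have n: "n > 0" using v v1 by (cases n) (auto simp: scalar_prod_def)
  define b where "b = basis_completion v"
  note b = basis_completion[OF v v0, folded b_def]
  have "hd b = v" "length b = n" using b by auto
  then obtain vs where bv: "b = v # vs" using n by (cases b) auto
  define ws where "ws = gram_schmidt n b"
  have ws: "set ws \<subseteq> carrier_vec n" "corthogonal ws" "length ws = n"
    using gram_schmidt_result[OF _ _ _ ws_def] b by auto
  have "hd ws = v" unfolding ws_def bv by (rule gram_schmidt_hd[OF v])
  hence ws0: "ws ! 0 = v" using ws(3) n by (cases ws) auto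
  have wsc: "ws ! i \<in> carrier_vec n" if "i < n" for i
    using ws(1,3) that by auto
  have orth: "ws ! i \<bullet> ws ! j = 0 \<longleftrightarrow> i \<noteq> j" if "i < n" "j < n" for i j
    using corthogonalD[OF ws(2), of i j] that ws(3) by simp
  \<comment> \<open>Gram-Schmidt yields orthogonal vectors of arbitrary length; the rescaling leaves
    \<open>v\<close> unchanged because it is already a unit vector.\<close>
  define u where "u j = (1 / sqrt (ws ! j \<bullet> ws ! j)) \<cdot>\<^sub>v ws ! j" for j
  have uc: "u j \<in> carrier_vec n" if "j < n" for j using wsc[OF that] by (simp add: u_def)
  have uu: "u i \<bullet> u j = (if i = j then 1 else 0)" if ij: "i < n" "j < n" for i j
  proof -
    have "ws ! j \<bullet> ws ! j \<ge> 0" using conjugate_square_ge_0_vec[of "ws ! j"] by simp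
    thus ?thesis using wsc[OF ij(1)] wsc[OF ij(2)] orth[OF ij]
      by (auto simp: u_def)
  qed
  define W where "W = mat_of_cols n (map u [0..<n])"
  have W: "W \<in> carrier_mat n n" unfolding W_def by auto
  have colW: "col W j = u j" if "j < n" for j
    unfolding W_def using that uc[OF that] by (subst col_mat_of_cols) auto
  have "transpose_mat W * W = 1\<^sub>m n"
    by (rule eq_matI) (use W in \<open>auto simp: colW uu\<close>)
  moreover have "col W 0 = v"
    using colW[OF n] v1 by (auto simp: u_def ws0)
  ultimately show ?thesis using W by blast
qed

lemma unit_eigenvector:
  fixes A :: "real mat"
  assumes A: "A \<in> carrier_mat n n" and root: "poly (char_poly A) e = 0"
  shows "\<exists>v \<in> carrier_vec n. v \<bullet> v = 1 \<and> A *\<^sub>v v = e \<cdot>\<^sub>v v"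
proof -
  obtain w where w: "w \<in> carrier_vec n" "w \<noteq> 0\<^sub>v n" and ev: "A *\<^sub>v w = e \<cdot>\<^sub>v w"
    using root A unfolding eigenvalue_root_char_poly[OF A, symmetric] eigenvalue_def eigenvector_def
    by auto
  have pos: "w \<bullet> w > 0" using conjugate_square_greater_0_vec[OF w(1)] w(2) by simp
  define v where "v = (1 / sqrt (w \<bullet> w)) \<cdot>\<^sub>v w"
  have v: "v \<in> carrier_vec n" using w by (simp add: v_def)
  moreover have "v \<bullet> v = 1" using pos w by (simp add: v_def)
  moreover have "A *\<^sub>v v = e \<cdot>\<^sub>v v"
    unfolding v_def mult_mat_vec[OF A w(1)] ev by (simp add: smult_smult_assoc mult.commute)
  ultimately show ?thesis by blast
qed

text \<open>Deflation: split off one unit eigenvector and recurse on the orthogonal complement. The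
  diagonal follows the order of \<open>es\<close>, whatever it is, so a sorted list of roots gives a
  sorted diagonal.\<close>

theorem spectral_theorem:
  fixes A :: "real mat"
  assumes "A \<in> carrier_mat n n" and "transpose_mat A = A"
    and "char_poly A = (\<Prod>e\<leftarrow>es. [:- e, 1:])"
  shows "\<exists>P \<in> carrier_mat n n. transpose_mat P * P = 1\<^sub>m n
    \<and> transpose_mat P * A * P = mat_diag n (\<lambda>i. es ! i)"
  using assms
proof (induction es arbitrary: A n)
  case Nil
  hence "n = 0" using degree_monic_char_poly[of A n] by simp
  thus ?case using Nil by (intro bexI[of _ "1\<^sub>m 0"]) (auto intro!: eq_matI simp: mat_diag_def)
next
  case (Cons e es A n)
  note A = Cons.prems(1) and sym = Cons.prems(2) and cp = Cons.prems(3)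
  have root: "poly (char_poly A) e = 0" unfolding cp by simp
  have "degree (char_poly A) \<noteq> 0"
    unfolding cp degree_linear_factors by simp
  then obtain k where n: "n = Suc k"
    using degree_monic_char_poly[OF A] by (cases n) auto
  obtain v where v: "v \<in> carrier_vec n" "v \<bullet> v = 1" and ev: "A *\<^sub>v v = e \<cdot>\<^sub>v v"
    using unit_eigenvector[OF A root] by blast
  obtain W where W: "W \<in> carrier_mat n n" and WW: "transpose_mat W * W = 1\<^sub>m n"
    and W0: "col W 0 = v"
    using orthogonal_completion[OF v] by blast
  let ?T = "transpose_mat W"
  have T: "?T \<in> carrier_mat n n" using W by simp
  have WT: "W * ?T = 1\<^sub>m n" using mat_mult_left_right_inverse[OF T W WW] .
  define A' where "A' = ?T * A * W"
  have A': "A' \<in> carrier_mat n n" using A W by (simp add: A'_def)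
  have symA': "transpose_mat A' = A'"
    unfolding A'_def using A W T sym
    by (simp add: transpose_mult[of _ n n _ n])
  \<comment> \<open>The first column of \<open>W\<close> is an eigenvector and the columns of
    \<open>W\<close> are orthonormal. Symmetry then gives the first row, leaving a block
    \<open>B\<close> of size \<open>k\<close>.\<close>
  have A'0: "A' $$ (i, 0) = (if i = 0 then e else 0)" if i: "i < n" for i
  proof -
    have "A' $$ (i, 0) = (?T * (A * W)) $$ (i, 0)"
      unfolding A'_def using A W T by simp
    also have "\<dots> = row ?T i \<bullet> (A *\<^sub>v v)"
    proof -
      have "col (A * W) 0 = A *\<^sub>v v" using col_mult2[OF A W, of 0] n W0 by simp
      moreover have "(?T * (A * W)) $$ (i, 0) = row ?T i \<bullet> col (A * W) 0"
        by (rule index_mult_mat(1)) (use A W i n in auto)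
      ultimately show ?thesis by simp
    qed
    also have "\<dots> = e * (col W i \<bullet> col W 0)"
      unfolding ev W0 using W i v by simp
    also have "col W i \<bullet> col W 0 = (?T * W) $$ (i, 0)" using W i n by simp
    finally show ?thesis unfolding WW using i n by simp
  qed
  have A'0': "A' $$ (0, i) = (if i = 0 then e else 0)" if i: "i < n" for i
    using A'0[OF i] A' i n by (metis symA' carrier_matD index_transpose_mat(1) zero_less_Suc)
  define B where "B = mat k k (\<lambda>(i, j). A' $$ (Suc i, Suc j))"
  have B: "B \<in> carrier_mat k k" by (simp add: B_def)
  let ?E = "mat 1 1 (\<lambda>_. e)"
  have block: "A' = four_block_mat ?E (0\<^sub>m 1 k) (0\<^sub>m k 1) B"
    by (rule eq_matI) (use A' n A'0 A'0' in \<open>auto simp: B_def\<close>)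
  have symB: "transpose_mat B = B"
  proof (rule eq_matI)
    fix i j assume ij: "i < dim_row B" "j < dim_col B"
    hence "A' $$ (Suc j, Suc i) = transpose_mat A' $$ (Suc i, Suc j)"
      using A' n by (simp add: B_def)
    thus "transpose_mat B $$ (i, j) = B $$ (i, j)"
      using ij by (simp add: symA' B_def)
  qed (auto simp: B_def)
  have "similar_mat A' A"
    by (rule similar_matI[of _ _ ?T W n]) (use A A' T W WW WT in \<open>auto simp: A'_def\<close>)
  hence "char_poly A' = char_poly A" by (rule char_poly_similar)
  moreover have "char_poly A' = char_poly ?E * char_poly B"
    unfolding block by (rule char_poly_four_block_zeros_col[OF _ _ B]) auto
  moreover have "char_poly ?E = [:- e, 1:]"
    by (simp add: char_poly_defs det_def sign_def)
  \<comment> \<open>Similarity preserves the characteristic polynomial, so cancelling the factor of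
    the split-off eigenvalue leaves the induction hypothesis applicable to \<open>B\<close>.\<close>
  ultimately have cpB: "char_poly B = (\<Prod>e\<leftarrow>es. [:- e, 1:])"
    using cp by (metis (no_types, lifting) list.simps(9) prod_list.Cons mult_cancel_left pCons_eq_0_iff zero_neq_one)
  obtain U where U: "U \<in> carrier_mat k k" and UU: "transpose_mat U * U = 1\<^sub>m k"
    and UBU: "transpose_mat U * B * U = mat_diag k (\<lambda>i. es ! i)"
    using Cons.IH[OF B symB cpB] by blast
  \<comment> \<open>\<open>F\<close> fixes the first coordinate, so it diagonalizes \<open>B\<close>
    without disturbing the entry \<open>e\<close>; the required matrix is
    \<open>W * F\<close>.\<close>
  define F where "F = four_block_mat (1\<^sub>m 1) (0\<^sub>m 1 k) (0\<^sub>m k 1) U"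
  let ?V = "transpose_mat F"
  have F: "F \<in> carrier_mat n n"
    unfolding F_def n using four_block_carrier_mat[OF one_carrier_mat U, of 1] by simp
  have V: "?V \<in> carrier_mat n n" using F by simp
  have Vb: "?V = four_block_mat (1\<^sub>m 1) (0\<^sub>m 1 k) (0\<^sub>m k 1) (transpose_mat U)"
    unfolding F_def using U by (subst transpose_four_block_mat[of _ 1 1 _ k _ k]) auto
  have tU: "transpose_mat U \<in> carrier_mat k k" using U by simp
  have FF: "?V * F = 1\<^sub>m n"
    unfolding Vb unfolding F_def n
    by (subst mult_four_block_mat[of _ 1 1 _ k _ k]) (use U tU UU in auto)
  have "?V * A' = four_block_mat ?E (0\<^sub>m 1 k) (0\<^sub>m k 1) (transpose_mat U * B)"
    unfolding Vb block
    by (subst mult_four_block_mat[of _ 1 1 _ k _ k]) (use U tU B in auto)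
  hence "?V * A' * F = four_block_mat ?E (0\<^sub>m 1 k) (0\<^sub>m k 1) (transpose_mat U * B * U)"
    unfolding F_def
    by (simp, subst mult_four_block_mat[of _ 1 1 _ k _ k]) (use U tU B in auto)
  also have "\<dots> = mat_diag n (\<lambda>i. (e # es) ! i)"
    unfolding UBU n by (rule eq_matI) (auto simp: mat_diag_def)
  finally have VAF: "?V * A' * F = mat_diag n (\<lambda>i. (e # es) ! i)" .
  have tP: "transpose_mat (W * F) = ?V * ?T" by (rule transpose_mult[OF W F])
  have "transpose_mat (W * F) * (W * F) = ?V * (?T * W) * F"
    unfolding tP using W F T V by (simp add: assoc_mult_mat[of _ n n _ n _ n])
  also have "\<dots> = 1\<^sub>m n" using WW FF V by simp
  finally have 1: "transpose_mat (W * F) * (W * F) = 1\<^sub>m n" .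
  have "transpose_mat (W * F) * A * (W * F) = ?V * A' * F"
    unfolding tP A'_def using W F T V A
    by (simp add: assoc_mult_mat[of _ n n _ n _ n])
  with 1 VAF show ?case using W F by (intro bexI[of _ "W * F"]) auto
qed

lemma mat_diag_mult_vec:
  fixes w :: "'a :: semiring_0 vec"
  assumes w: "w \<in> carrier_vec n"
  shows "mat_diag n f *\<^sub>v w = vec n (\<lambda>i. f i * w $ i)"
proof (rule eq_vecI)
  fix i assume "i < dim_vec (vec n (\<lambda>i. f i * w $ i))"
  hence i: "i < n" by simp
  have "(mat_diag n f *\<^sub>v w) $ i = (\<Sum>j\<in>{0..<n}. (if i = j then f j else 0) * w $ j)"
    using i w by (simp add: mat_diag_def scalar_prod_def)
  also have "\<dots> = (\<Sum>j\<in>{0..<n}. if i = j then f j * w $ j else 0)"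
    by (intro sum.cong) auto
  finally show "(mat_diag n f *\<^sub>v w) $ i = vec n (\<lambda>i. f i * w $ i) $ i"
    using i by simp
qed (simp add: mat_diag_def)

text \<open>Row \<open>i\<close> of \<open>Q\<close> is a unit eigenvector for the \<open>i\<close>-th entry of \<open>eigvals_desc A\<close>.\<close>

lemma quadratic_form_diagonalization:
  fixes A :: "real mat"
  assumes A: "A \<in> carrier_mat n n" and sym: "transpose_mat A = A"
  obtains Q where "Q \<in> carrier_mat n n"
    and "\<And>v. v \<in> carrier_vec n \<Longrightarrow> v \<bullet> v = (\<Sum>i<n. ((Q *\<^sub>v v) $ i)\<^sup>2)"
    and "\<And>v. v \<in> carrier_vec n \<Longrightarrow>
      v \<bullet> (A *\<^sub>v v) = (\<Sum>i<n. eigvals_desc A ! i * ((Q *\<^sub>v v) $ i)\<^sup>2)"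
proof -
  let ?D = "mat_diag n (\<lambda>i. eigvals_desc A ! i)"
  obtain P where P: "P \<in> carrier_mat n n" and PP: "transpose_mat P * P = 1\<^sub>m n"
    and PAP: "transpose_mat P * A * P = ?D"
    using spectral_theorem[OF A sym char_poly_eigvals_desc(1)[OF A sym]] by blast
  \<comment> \<open>\<open>P\<close> is square with orthonormal columns, so \<open>Q\<close> is its
    two-sided inverse and yields coordinates in the eigenbasis.\<close>
  define Q where "Q = transpose_mat P"
  have Q: "Q \<in> carrier_mat n n" and tQ: "transpose_mat Q = P" using P by (auto simp: Q_def)
  have PQ: "P * Q = 1\<^sub>m n"
    using mat_mult_left_right_inverse[OF Q P] PP by (simp add: Q_def)
  have D: "?D \<in> carrier_mat n n" by simp
  have inv: "P *\<^sub>v (Q *\<^sub>v v) = v" if v: "v \<in> carrier_vec n" for v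
    using assoc_mult_mat_vec[OF P Q v] v by (simp add: PQ)
  have form: "v \<bullet> (P *\<^sub>v w) = (Q *\<^sub>v v) \<bullet> w"
    if "v \<in> carrier_vec n" "w \<in> carrier_vec n" for v w
    using transpose_vec_mult_scalar[OF P that(2,1)] by (simp add: Q_def)
  have "P * ?D * Q = P * (Q * A * P) * Q" using PAP by (simp add: Q_def)
  also have "\<dots> = (P * Q) * A * (P * Q)"
    using P Q A by (simp add: assoc_mult_mat[of _ n n _ n _ n])
  finally have A_eq: "A = P * ?D * Q" using A by (simp add: PQ)
  show ?thesis
  proof (rule that[OF Q])
    fix v :: "real vec" assume v: "v \<in> carrier_vec n"
    have Qv: "Q *\<^sub>v v \<in> carrier_vec n" using Q v by simp
    have "v \<bullet> v = (Q *\<^sub>v v) \<bullet> (Q *\<^sub>v v)"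
      using form[OF v Qv] inv[OF v] by simp
    thus "v \<bullet> v = (\<Sum>i<n. ((Q *\<^sub>v v) $ i)\<^sup>2)"
      using Q by (simp add: scalar_prod_def power2_eq_square lessThan_atLeast0)
    have "A *\<^sub>v v = P *\<^sub>v (?D *\<^sub>v (Q *\<^sub>v v))"
      using P Q D v by (subst A_eq) (simp add: assoc_mult_mat_vec[of _ n n _ n])
    hence "v \<bullet> (A *\<^sub>v v) = (Q *\<^sub>v v) \<bullet> (?D *\<^sub>v (Q *\<^sub>v v))"
      using form[OF v, of "?D *\<^sub>v (Q *\<^sub>v v)"] D Qv by simp
    also have "?D *\<^sub>v (Q *\<^sub>v v) = vec n (\<lambda>i. eigvals_desc A ! i * (Q *\<^sub>v v) $ i)"
      by (rule mat_diag_mult_vec[OF Qv])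
    finally show "v \<bullet> (A *\<^sub>v v) = (\<Sum>i<n. eigvals_desc A ! i * ((Q *\<^sub>v v) $ i)\<^sup>2)"
      using Qv by (simp add: scalar_prod_def power2_eq_square lessThan_atLeast0 ac_simps)
  qed
qed

section \<open>Eigenvalue perturbation\<close>

text \<open>Rayleigh bound: in eigenbasis coordinates the form is a sum of squares whose weights are
  at most the first one.\<close>

lemma scalar_prod_mult_le_eigval_1:
  assumes A: "A \<in> carrier_mat n n" and sym: "transpose_mat A = A" and v: "v \<in> carrier_vec n"
  shows "v \<bullet> (A *\<^sub>v v) \<le> eigval 1 A * (v \<bullet> v)"
proof -
  obtain Q where Q: "\<And>v. v \<in> carrier_vec n \<Longrightarrow> v \<bullet> v = (\<Sum>i<n. ((Q *\<^sub>v v) $ i)\<^sup>2)"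
    "\<And>v. v \<in> carrier_vec n \<Longrightarrow>
      v \<bullet> (A *\<^sub>v v) = (\<Sum>i<n. eigvals_desc A ! i * ((Q *\<^sub>v v) $ i)\<^sup>2)"
    by (rule quadratic_form_diagonalization[OF A sym]) blast
  show ?thesis
    unfolding Q(1)[OF v] Q(2)[OF v] sum_distrib_left eigval_def
    by (intro sum_mono mult_right_mono char_poly_eigvals_desc(3)[OF A sym]) auto
qed

text \<open>Weyl's inequality in one-sided form. With \<open>p = i - 1\<close>, asking a vector to
  have no component along the first \<open>p\<close> eigenvectors of \<open>B\<close> and the last
  \<open>m - p - 1\<close> of \<open>A\<close> is \<open>m - 1\<close> linear conditions, so some
  nonzero \<open>v\<close> meets them all.\<close>

lemma eigval_mono_perturbation:
  assumes A: "A \<in> carrier_mat m m" and symA: "transpose_mat A = A"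
    and B: "B \<in> carrier_mat m m" and symB: "transpose_mat B = B"
    and le: "\<And>v. v \<in> carrier_vec m \<Longrightarrow> v \<bullet> (A *\<^sub>v v) \<le> v \<bullet> (B *\<^sub>v v) + c * (v \<bullet> v)"
    and i: "i \<in> {1..m}"
  shows "eigval i A \<le> eigval i B + c"
proof -
  obtain Q where Q: "Q \<in> carrier_mat m m"
    "\<And>v. v \<in> carrier_vec m \<Longrightarrow> v \<bullet> v = (\<Sum>i<m. ((Q *\<^sub>v v) $ i)\<^sup>2)"
    "\<And>v. v \<in> carrier_vec m \<Longrightarrow>
      v \<bullet> (A *\<^sub>v v) = (\<Sum>i<m. eigvals_desc A ! i * ((Q *\<^sub>v v) $ i)\<^sup>2)"
    by (rule quadratic_form_diagonalization[OF A symA]) blast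
  obtain R where R: "R \<in> carrier_mat m m"
    "\<And>v. v \<in> carrier_vec m \<Longrightarrow> v \<bullet> v = (\<Sum>i<m. ((R *\<^sub>v v) $ i)\<^sup>2)"
    "\<And>v. v \<in> carrier_vec m \<Longrightarrow>
      v \<bullet> (B *\<^sub>v v) = (\<Sum>i<m. eigvals_desc B ! i * ((R *\<^sub>v v) $ i)\<^sup>2)"
    by (rule quadratic_form_diagonalization[OF B symB]) blast
  define p where "p = i - 1"
  have p: "p < m" using i by (auto simp: p_def)
  \<comment> \<open>A kernel vector of \<open>M\<close> lies in the span of the first \<open>i\<close> eigenvectors of \<open>A\<close> and of
    the last \<open>m - i + 1\<close> eigenvectors of \<open>B\<close>; it exists because row \<open>p\<close> of \<open>M\<close> vanishes.\<close>
  define c' where "c' j = (if j < p then row R j else row Q j)" for j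
  define M where "M = mat\<^sub>r m m (\<lambda>j. if j = p then 0\<^sub>v m else c' j)"
  have M: "M \<in> carrier_mat m m" by (simp add: M_def)
  have "det M = 0"
    unfolding M_def by (rule det_row_0[OF p]) (use Q(1) R(1) in \<open>auto simp: c'_def\<close>)
  then obtain v where v: "v \<in> carrier_vec m" "v \<noteq> 0\<^sub>v m" "M *\<^sub>v v = 0\<^sub>v m"
    using det_0_iff_vec_prod_zero[OF M] by blast
  have Mv: "(M *\<^sub>v v) $ j = 0" if "j < m" for j using v(3) that by simp
  have R0: "(R *\<^sub>v v) $ j = 0" if j: "j < p" for j
    using Mv[of j] j p R(1) v(1) by (simp add: M_def c'_def scalar_prod_def)
  have Q0: "(Q *\<^sub>v v) $ j = 0" if j: "p < j" "j < m" for j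
    using Mv[of j] j p Q(1) v(1) by (simp add: M_def c'_def scalar_prod_def)
  have pos: "v \<bullet> v > 0" using conjugate_square_greater_0_vec[OF v(1)] v(2) by simp
  \<comment> \<open>Only coordinates with index at most \<open>p\<close> survive for
    \<open>A\<close>, and their weights are at least entry \<open>p\<close>. For \<open>B\<close>
    the surviving indices are at least \<open>p\<close>, which gives the opposite estimate.\<close>
  have "eigval i A * (v \<bullet> v) \<le> v \<bullet> (A *\<^sub>v v)"
    unfolding Q(2)[OF v(1)] Q(3)[OF v(1)] sum_distrib_left eigval_def p_def[symmetric]
  proof (rule sum_mono)
    fix j assume "j \<in> {..<m}"
    thus "eigvals_desc A ! p * ((Q *\<^sub>v v) $ j)\<^sup>2 \<le> eigvals_desc A ! j * ((Q *\<^sub>v v) $ j)\<^sup>2"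
      using char_poly_eigvals_desc(3)[OF A symA, of j p] Q0[of j] p
      by (cases "j \<le> p") (auto intro!: mult_right_mono)
  qed
  also have "\<dots> \<le> v \<bullet> (B *\<^sub>v v) + c * (v \<bullet> v)" by (rule le[OF v(1)])
  also have "v \<bullet> (B *\<^sub>v v) \<le> eigval i B * (v \<bullet> v)"
    unfolding R(2)[OF v(1)] R(3)[OF v(1)] sum_distrib_left eigval_def p_def[symmetric]
  proof (rule sum_mono)
    fix j assume "j \<in> {..<m}"
    thus "eigvals_desc B ! j * ((R *\<^sub>v v) $ j)\<^sup>2 \<le> eigvals_desc B ! p * ((R *\<^sub>v v) $ j)\<^sup>2"
      using char_poly_eigvals_desc(3)[OF B symB, of p j] R0[of j]
      by (cases "j < p") (auto intro!: mult_right_mono)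
  qed
  finally have "eigval i A * (v \<bullet> v) \<le> (eigval i B + c) * (v \<bullet> v)"
    by (simp add: algebra_simps)
  thus ?thesis using pos by simp
qed

section \<open>The largest singular value as an operator norm\<close>

definition vnorm :: "real vec \<Rightarrow> real" where
  "vnorm v = sqrt (v \<bullet> v)"

text \<open>Bridge through which the triangle and Cauchy-Schwarz inequalities are inherited from
  \<open>L2_set\<close>.\<close>

lemma vnorm_L2_set: "v \<in> carrier_vec n \<Longrightarrow> vnorm v = L2_set (\<lambda>i. v $ i) {0..<n}"
  by (simp add: vnorm_def L2_set_def scalar_prod_def power2_eq_square)

lemma vnorm_nonneg: "vnorm v \<ge> 0"
  using conjugate_square_ge_0_vec[of v] by (simp add: vnorm_def)

lemma vnorm_square: "(vnorm v)\<^sup>2 = v \<bullet> v"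
  using conjugate_square_ge_0_vec[of v] by (simp add: vnorm_def)

lemma vnorm_triangle:
  assumes "v \<in> carrier_vec n" and "w \<in> carrier_vec n"
  shows "vnorm (v + w) \<le> vnorm v + vnorm w"
proof -
  have "L2_set (\<lambda>i. (v + w) $ i) {0..<n} = L2_set (\<lambda>i. v $ i + w $ i) {0..<n}"
    using assms by (intro L2_set_cong) auto
  thus ?thesis using assms L2_set_triangle_ineq[of "\<lambda>i. v $ i" "\<lambda>i. w $ i" "{0..<n}"]
    by (simp add: vnorm_L2_set[of _ n])
qed

lemma vnorm_smult: "vnorm (c \<cdot>\<^sub>v v) = \<bar>c\<bar> * vnorm v"
proof -
  have "(c \<cdot>\<^sub>v v) \<bullet> (c \<cdot>\<^sub>v v) = c\<^sup>2 * (v \<bullet> v)"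
    by (simp add: power2_eq_square)
  thus ?thesis by (simp add: vnorm_def real_sqrt_mult)
qed

lemma scalar_prod_le_vnorm:
  assumes "v \<in> carrier_vec n" and "w \<in> carrier_vec n"
  shows "v \<bullet> w \<le> vnorm v * vnorm w"
proof -
  have "v \<bullet> w \<le> (\<Sum>i\<in>{0..<n}. \<bar>v $ i\<bar> * \<bar>w $ i\<bar>)"
    using assms by (auto simp: scalar_prod_def abs_mult[symmetric] intro!: sum_mono)
  also have "\<dots> \<le> vnorm v * vnorm w"
    using L2_set_mult_ineq[of "\<lambda>i. v $ i" "\<lambda>i. w $ i" "{0..<n}"] assms
    by (simp add: vnorm_L2_set[of _ n])
  finally show ?thesis .
qed

text \<open>The quadratic form of \<open>transpose_mat X * X\<close> at \<open>w\<close> is the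
  squared length of \<open>X *\<^sub>v w\<close>; apply the Rayleigh bound and take square
  roots.\<close>

lemma vnorm_mult_le_singval_1:
  assumes X: "X \<in> carrier_mat m n" and w: "w \<in> carrier_vec n"
  shows "vnorm (X *\<^sub>v w) \<le> singval 1 X * vnorm w"
proof -
  let ?S = "transpose_mat X * X"
  have S: "?S \<in> carrier_mat n n" using X by simp
  have sym: "transpose_mat ?S = ?S"
    using X by (subst transpose_mult[of _ n m _ n]) auto
  have "(X *\<^sub>v w) \<bullet> (X *\<^sub>v w) = w \<bullet> (?S *\<^sub>v w)"
    using X w transpose_vec_mult_scalar[OF X w, of "X *\<^sub>v w"]
    by (simp add: assoc_mult_mat_vec[of _ n m _ n] comm_scalar_prod[of w n])
  also have "\<dots> \<le> eigval 1 ?S * (w \<bullet> w)"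
    by (rule scalar_prod_mult_le_eigval_1[OF S sym w])
  finally show ?thesis
    unfolding vnorm_def singval_def by (simp add: real_sqrt_mult[symmetric])
qed

text \<open>For \<open>n = 0\<close> the value \<open>singval 1 X\<close> is unspecified.\<close>

lemma singval_1_nonneg:
  assumes X: "X \<in> carrier_mat m n" and n: "n \<ge> 1"
  shows "singval 1 X \<ge> 0"
proof -
  have "vnorm (X *\<^sub>v unit_vec n 0) \<le> singval 1 X * vnorm (unit_vec n 0)"
    by (rule vnorm_mult_le_singval_1[OF X]) simp
  thus ?thesis using n vnorm_nonneg[of "X *\<^sub>v unit_vec n 0"]
    by (simp add: vnorm_def[of "unit_vec n 0"])
qed

text \<open>The Gram matrix involves the transpose, while \<open>singval\<close> is defined by
  \<open>transpose_mat X * X\<close>. Duality bridges the two without comparing spectra: with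
  \<open>u\<close> the image of \<open>v\<close>, Cauchy-Schwarz bounds the square of
  \<open>vnorm u\<close> by \<open>vnorm v * vnorm (X *\<^sub>v u)\<close>, and one factor
  \<open>vnorm u\<close> cancels.\<close>

lemma vnorm_transpose_mult_le_singval_1:
  assumes X: "X \<in> carrier_mat m n" and n: "n \<ge> 1" and v: "v \<in> carrier_vec m"
  shows "vnorm (transpose_mat X *\<^sub>v v) \<le> singval 1 X * vnorm v"
proof (cases "vnorm (transpose_mat X *\<^sub>v v) = 0")
  case False
  let ?u = "transpose_mat X *\<^sub>v v"
  have u: "?u \<in> carrier_vec n" using X v by simp
  have "vnorm ?u * vnorm ?u = v \<bullet> (X *\<^sub>v ?u)"
    using transpose_vec_mult_scalar[OF X u v] by (simp add: vnorm_square flip: power2_eq_square)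
  also have "\<dots> \<le> vnorm v * vnorm (X *\<^sub>v ?u)"
    using X u v by (intro scalar_prod_le_vnorm[of _ m]) auto
  also have "\<dots> \<le> vnorm v * (singval 1 X * vnorm ?u)"
    by (intro mult_left_mono vnorm_mult_le_singval_1[OF X u] vnorm_nonneg)
  finally have "vnorm ?u * vnorm ?u \<le> (singval 1 X * vnorm v) * vnorm ?u"
    by (simp add: ac_simps)
  thus ?thesis using False vnorm_nonneg[of ?u] by simp
next
  case True
  thus ?thesis using singval_1_nonneg[OF X n] vnorm_nonneg[of v] by simp
qed

section \<open>Gram matrices along the segment\<close>

lemma gram_mat_quadratic_form:
  assumes X: "X \<in> carrier_mat m n" and v: "v \<in> carrier_vec m"
  shows "v \<bullet> (gram_mat X *\<^sub>v v) = (vnorm (transpose_mat X *\<^sub>v v))\<^sup>2"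
proof -
  have u: "transpose_mat X *\<^sub>v v \<in> carrier_vec n" using X v by simp
  show ?thesis
    using X v transpose_vec_mult_scalar[OF X u v]
    by (simp add: gram_mat_def vnorm_square assoc_mult_mat_vec[of _ m n _ m])
qed

lemma interp_mat_transpose_mult:
  assumes X: "X1 \<in> carrier_mat m n" "X2 \<in> carrier_mat m n" and v: "v \<in> carrier_vec m"
  shows "transpose_mat (interp_mat X1 X2 \<alpha>) *\<^sub>v v
    = \<alpha> \<cdot>\<^sub>v (transpose_mat X1 *\<^sub>v v) + (1 - \<alpha>) \<cdot>\<^sub>v (transpose_mat X2 *\<^sub>v v)"
  using X v by (intro eq_vecI)
    (auto simp: interp_mat_def scalar_prod_def sum.distrib sum_subtractf sum_distrib_left algebra_simps)

text \<open>The point \<open>z t\<close> runs along the segment from \<open>y\<close> to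
  \<open>x\<close>, whose length is at most \<open>r\<close>, and stays within distance
  \<open>r\<close> of the origin. The estimate is one-sided, but \<alpha> and \<beta> may come in
  either order.\<close>

lemma gram_interp_form_le:
  assumes X: "X1 \<in> carrier_mat m n" "X2 \<in> carrier_mat m n" and n: "n \<ge> 1"
    and v: "v \<in> carrier_vec m" and \<alpha>: "0 \<le> \<alpha>" "\<alpha> \<le> 1" and \<beta>: "0 \<le> \<beta>" "\<beta> \<le> 1"
  shows "v \<bullet> (gram_mat (interp_mat X1 X2 \<alpha>) *\<^sub>v v) \<le> v \<bullet> (gram_mat (interp_mat X1 X2 \<beta>) *\<^sub>v v)
    + 2 * \<bar>\<alpha> - \<beta>\<bar> * (singval 1 X1 + singval 1 X2)\<^sup>2 * (v \<bullet> v)"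
proof -
  define x y where "x = transpose_mat X1 *\<^sub>v v" and "y = transpose_mat X2 *\<^sub>v v"
  have xy: "x \<in> carrier_vec n" "y \<in> carrier_vec n" using X v by (auto simp: x_def y_def)
  have x: "vnorm x \<le> singval 1 X1 * vnorm v" and y: "vnorm y \<le> singval 1 X2 * vnorm v"
    unfolding x_def y_def using vnorm_transpose_mult_le_singval_1[OF X(1) n v] vnorm_transpose_mult_le_singval_1[OF X(2) n v]
    by blast+
  define r where "r = (singval 1 X1 + singval 1 X2) * vnorm v"
  have xyr: "vnorm x + vnorm y \<le> r" using x y by (simp add: r_def algebra_simps)
  define z where "z t = t \<cdot>\<^sub>v x + (1 - t) \<cdot>\<^sub>v y" for t
  have zc: "z t \<in> carrier_vec n" for t using xy by (simp add: z_def)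
  have zr: "vnorm (z t) \<le> r" if "0 \<le> t" "t \<le> 1" for t
  proof -
    have "vnorm (z t) \<le> t * vnorm x + (1 - t) * vnorm y"
      unfolding z_def using vnorm_triangle[of "t \<cdot>\<^sub>v x" n "(1 - t) \<cdot>\<^sub>v y"] xy that
      by (simp add: vnorm_smult)
    also have "\<dots> \<le> 1 * vnorm x + 1 * vnorm y"
      using that by (intro add_mono mult_right_mono vnorm_nonneg) auto
    finally show ?thesis using xyr by simp
  qed
  \<comment> \<open>Writing \<open>x - y\<close> as a sum lets \<open>vnorm_triangle\<close> and
    \<open>vnorm_smult\<close> bound it by \<open>vnorm x + vnorm y\<close>.\<close>
  have "z \<alpha> = z \<beta> + (\<alpha> - \<beta>) \<cdot>\<^sub>v (x + (-1) \<cdot>\<^sub>v y)"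
    using xy by (intro eq_vecI) (auto simp: z_def algebra_simps)
  hence "vnorm (z \<alpha>) \<le> vnorm (z \<beta>) + \<bar>\<alpha> - \<beta>\<bar> * vnorm (x + (-1) \<cdot>\<^sub>v y)"
    using vnorm_triangle[OF zc, of "(\<alpha> - \<beta>) \<cdot>\<^sub>v (x + (-1) \<cdot>\<^sub>v y)" \<beta>] xy
    by (simp add: vnorm_smult)
  also have "vnorm (x + (-1) \<cdot>\<^sub>v y) \<le> r"
    using vnorm_triangle[of x n "(-1) \<cdot>\<^sub>v y"] xy xyr by (simp add: vnorm_smult)
  finally have diff: "vnorm (z \<alpha>) - vnorm (z \<beta>) \<le> \<bar>\<alpha> - \<beta>\<bar> * r"
    by (simp add: mult_left_mono)
  have r: "0 \<le> r" using zr[OF \<alpha>] vnorm_nonneg[of "z \<alpha>"] by linarith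
  have "(vnorm (z \<alpha>))\<^sup>2 - (vnorm (z \<beta>))\<^sup>2
      = (vnorm (z \<alpha>) - vnorm (z \<beta>)) * (vnorm (z \<alpha>) + vnorm (z \<beta>))"
    by (simp add: power2_eq_square algebra_simps)
  \<comment> \<open>The first factor may be negative, so it is replaced first, against the
    nonnegative sum of norms; only then is that sum replaced by \<open>2 * r\<close>.\<close>
  also have "\<dots> \<le> (\<bar>\<alpha> - \<beta>\<bar> * r) * (2 * r)"
    using diff zr[OF \<alpha>] zr[OF \<beta>] r
    by (intro order_trans[OF mult_right_mono[OF diff] mult_left_mono])
      (auto simp: vnorm_nonneg intro: add_nonneg_nonneg)
  also have "\<dots> = 2 * \<bar>\<alpha> - \<beta>\<bar> * (singval 1 X1 + singval 1 X2)\<^sup>2 * (v \<bullet> v)"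
    unfolding r_def vnorm_square[symmetric] by (simp add: power2_eq_square)
  finally have main: "(vnorm (z \<alpha>))\<^sup>2 \<le> (vnorm (z \<beta>))\<^sup>2
      + 2 * \<bar>\<alpha> - \<beta>\<bar> * (singval 1 X1 + singval 1 X2)\<^sup>2 * (v \<bullet> v)" by simp
  have XI: "interp_mat X1 X2 t \<in> carrier_mat m n" for t using X by (simp add: interp_mat_def)
  show ?thesis
    using main unfolding gram_mat_quadratic_form[OF XI v] interp_mat_transpose_mult[OF X v]
      z_def x_def y_def .
qed

theorem mainTheorem1:
  fixes X1 X2 :: "real mat" and m n K :: nat and G :: "real \<Rightarrow> real mat" and \<alpha>s :: "nat \<Rightarrow> real"
  assumes "m \<ge> 1" and "n \<ge> 1" and "K \<ge> 1"
    and "X1 \<in> carrier_mat m n" and "X2 \<in> carrier_mat m n"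
  defines "G \<equiv> \<lambda>\<alpha>. gram_mat (interp_mat X1 X2 \<alpha>)"
    and "\<alpha>s \<equiv> \<lambda>k. real k / real K"
  shows "\<forall>k\<in>{0..<K}. \<forall>\<alpha>\<in>{\<alpha>s k..\<alpha>s (k + 1)}. \<forall>i\<in>{1..m}.
    \<bar>eigval i (G \<alpha>) - eigval i (G (\<alpha>s k))\<bar> \<le> 2 / real K * (singval 1 X1 + singval 1 X2)\<^sup>2"
proof (intro ballI)
  fix k \<alpha> i
  assume k: "k \<in> {0..<K}" and \<alpha>: "\<alpha> \<in> {\<alpha>s k..\<alpha>s (k + 1)}" and i: "i \<in> {1..m}"
  let ?s = "(singval 1 X1 + singval 1 X2)\<^sup>2"
  have XI: "interp_mat X1 X2 t \<in> carrier_mat m n" for t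
    using assms(4,5) by (simp add: interp_mat_def)
  have G: "G t \<in> carrier_mat m m" for t using XI[of t] by (simp add: G_def gram_mat_def)
  have sym: "transpose_mat (G t) = G t" for t
    unfolding G_def gram_mat_def using XI[of t] by (subst transpose_mult[of _ m n _ m]) auto
  have K: "real K > 0" using assms(3) by simp
  \<comment> \<open>Since \<open>k < K\<close>, the whole subinterval lies in the unit interval,
    where the form estimate is available.\<close>
  have k01: "0 \<le> \<alpha>s k" "\<alpha>s (k + 1) \<le> 1" using k K by (auto simp: \<alpha>s_def field_simps)
  hence range: "0 \<le> \<alpha>" "\<alpha> \<le> 1" "\<alpha>s k \<le> 1" using \<alpha> by auto
  have "\<alpha>s (k + 1) = \<alpha>s k + 1 / real K" by (simp add: \<alpha>s_def add_divide_distrib)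
  hence step: "\<bar>\<alpha> - \<alpha>s k\<bar> \<le> 1 / real K" using \<alpha> by auto
  \<comment> \<open>Every ordered eigenvalue is Lipschitz on the unit interval with constant
    \<open>2 * ?s\<close>; using the bound in both orders gives the absolute value, and the grid
    spacing \<open>1 / real K\<close> finishes.\<close>
  have bound: "eigval i (G t) \<le> eigval i (G u) + 2 * \<bar>t - u\<bar> * ?s"
    if "0 \<le> t" "t \<le> 1" "0 \<le> u" "u \<le> 1" for t u
    using gram_interp_form_le[OF assms(4,5,2) _ that]
    by (intro eigval_mono_perturbation[OF G sym G sym _ i]) (simp add: G_def)
  have "\<bar>eigval i (G \<alpha>) - eigval i (G (\<alpha>s k))\<bar> \<le> 2 * \<bar>\<alpha> - \<alpha>s k\<bar> * ?s"
    using bound[OF range(1,2) k01(1) range(3)] bound[OF k01(1) range(3) range(1,2)]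
    by (simp add: abs_le_iff abs_minus_commute)
  also have "\<dots> \<le> 2 * (1 / real K) * ?s"
    using step by (intro mult_right_mono mult_left_mono) auto
  finally show "\<bar>eigval i (G \<alpha>) - eigval i (G (\<alpha>s k))\<bar> \<le> 2 / real K * ?s" by simp
qed

end
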